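(* Let $d\ge 2$ be a constant integer. For a $c$-chain $P$ with $n$ vertices in $\mathbb{R}^d$ we have $$\delta_P=O\left(c^2(n-1)^{(d-1)/d}\right).$$ That is, for every integer $d\ge2$ there is a constant $C_d>0$ depending only on $d$ such that for every real number $c\ge 1$, every integer $n\ge 2$, and every $c$-chain $P=(p_1,\dots,p_n)$ in $\mathbb{R}^d$ with $n$ vertices and $p_1\neq p_n$, we have $\delta_P\le C_d\,c^2(n-1)^{(d-1)/d}$.
   Context: A polygonal chain $P=(p_1,\dots,p_n)$ in $\mathbb{R}^d$ is specified by a sequence of $n$ points $p_1,\dots,p_n$, called its vertices; it consists of the $n-1$ line segments between consecutive vertices. $|pq|$ denotes the Euclidean distance between $p$ and $q$. For a real number $c\ge 1$, $P$ is called a $c$-chain if $|p_ip_j|+|p_jp_k|\le c\,|p_ip_k|$ for all $1\le i<j<k\le n$. The stretch factor of $P$ is $$\delta_P=\frac{\sum_{i=1}^{n-1}|p_ip_{i+1}|}{|p_1p_n|}.$$ *)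

theory Defs
  imports "HOL-Analysis.Analysis"
begin

text \<open>
  A polygonal chain with \<open>n\<close> vertices is given by a function \<open>p\<close> on the naturals, of which
  only the values \<open>p 1, \<dots>, p n\<close> matter; \<open>dist\<close> on \<open>real ^ 'd\<close> is the Euclidean distance.
\<close>

definition c_chain :: "real \<Rightarrow> nat \<Rightarrow> (nat \<Rightarrow> real ^ 'd) \<Rightarrow> bool" where
  "c_chain c n p \<longleftrightarrow>
     (\<forall>i j k. 1 \<le> i \<and> i < j \<and> j < k \<and> k \<le> n \<longrightarrow>
        dist (p i) (p j) + dist (p j) (p k) \<le> c * dist (p i) (p k))"

text \<open>Only meaningful if \<open>p 1 \<noteq> p n\<close>; otherwise HOL division by zero yields 0.\<close>

definition stretch_factor :: "nat \<Rightarrow> (nat \<Rightarrow> real ^ 'd) \<Rightarrow> real" where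
  "stretch_factor n p = (\<Sum>i = 1..n - 1. dist (p i) (p (i + 1))) / dist (p 1) (p n)"

end

theory Submission
  imports Defs
begin

text \<open>
  In a \<open>c\<close>-chain, the start points of the edges of length at least \<open>l\<close> are \<open>l / c\<close> apart, and
  they lie in a ball of radius \<open>c * dist (p 1) (p n)\<close>.  Comparing volumes, the \<open>k\<close>-th longest
  edge has length at most \<open>4 * c\<^sup>2 * dist (p 1) (p n) * k powr (- 1 / d)\<close>; summing over \<open>k\<close> gives
  the bound.
\<close>

text \<open>Balls of radius \<open>s / 2\<close> around the points of \<open>S\<close> are disjoint
  and fit into the ball of radius \<open>R + s / 2\<close> around \<open>a\<close>. In the
  comparison of volumes the factor \<open>?V\<close> of the unit ball cancels.\<close>

lemma card_separated_le:
  fixes S :: "'a::euclidean_space set"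
  assumes "finite S" and "S \<subseteq> cball a R" and "0 \<le> R" and "0 < s"
    and sep: "\<And>x y. x \<in> S \<Longrightarrow> y \<in> S \<Longrightarrow> x \<noteq> y \<Longrightarrow> s \<le> dist x y"
  shows "real (card S) * (s / 2) ^ DIM('a) \<le> (R + s / 2) ^ DIM('a)"
proof -
  let ?V = "measure lborel (ball (0::'a) 1)"
  have meas: "measure lborel (ball x r) = r ^ DIM('a) * ?V" if "0 \<le> r" for x :: 'a and r
    using content_ball_conv_unit_ball[OF that] .
  have V: "0 < ?V"
    by (simp add: content_ball_pos)
  have disj: "disjoint_family_on (\<lambda>x. ball x (s / 2)) S"
    unfolding disjoint_family_on_def
  proof (intro ballI impI)
    fix x y assume xy: "x \<in> S" "y \<in> S" "x \<noteq> y"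
    have "s \<le> dist x y" using sep[OF xy] .
    then show "ball x (s / 2) \<inter> ball y (s / 2) = {}"
      by (intro disjoint_ballI) simp
  qed
  have "(\<Union>x\<in>S. ball x (s / 2)) \<subseteq> ball a (R + s / 2)"
  proof
    fix z assume "z \<in> (\<Union>x\<in>S. ball x (s / 2))"
    then obtain x where "x \<in> S" "dist x z < s / 2" by auto
    moreover have "dist a x \<le> R" using \<open>x \<in> S\<close> assms(2) by auto
    moreover have "dist a z \<le> dist a x + dist x z" by (rule dist_triangle)
    ultimately show "z \<in> ball a (R + s / 2)" by simp
  qed
  then have "measure lborel (\<Union>x\<in>S. ball x (s / 2)) \<le> measure lborel (ball a (R + s / 2))"
    by (intro measure_mono_fmeasurable) (use \<open>finite S\<close> in
      \<open>auto intro!: sets.finite_UN simp: fmeasurable_def emeasure_lborel_ball_finite[simplified]\<close>)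
  also have "measure lborel (\<Union>x\<in>S. ball x (s / 2))
      = (\<Sum>x\<in>S. measure lborel (ball x (s / 2)))"
    by (intro measure_finite_Union disj \<open>finite S\<close>)
      (use less_imp_neq[OF emeasure_lborel_ball_finite] in auto)
  finally have "(real (card S) * (s / 2) ^ DIM('a)) * ?V \<le> (R + s / 2) ^ DIM('a) * ?V"
    using \<open>0 \<le> R\<close> \<open>0 < s\<close> by (simp add: meas[of "s / 2"] meas[of "R + s / 2"])
  then show ?thesis
    using V by simp
qed

text \<open>By the mean value theorem the difference is \<open>a * z powr (a - 1)\<close> with
  \<open>z < Suc n\<close>, and this derivative is nonincreasing because \<open>a \<le> 1\<close>.
  Multiplied by \<open>1 / a\<close>, the inequality makes sums of \<open>k powr (a - 1)\<close>
  telescope.\<close>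

lemma powr_diff_ge:
  fixes a :: real
  assumes "0 < a" "a \<le> 1"
  shows "a * real (Suc n) powr (a - 1) \<le> real (Suc n) powr a - real n powr a"
\<comment> \<open>For \<open>a < 1\<close> the power is not differentiable at 0; there the claim is
  just \<open>a \<le> 1\<close>.\<close>
proof (cases "n = 0")
  case True
  then show ?thesis using assms by simp
next
  case False
  have "\<exists>z::real. real n < z \<and> z < real (Suc n) \<and>
      real (Suc n) powr a - real n powr a = (real (Suc n) - real n) * (a * z powr (a - 1))"
    using False by (intro MVT2) (auto intro!: has_real_derivative_powr)
  then obtain z where z: "real n < z" "z < real (Suc n)"
    and eq: "real (Suc n) powr a - real n powr a = a * z powr (a - 1)" by auto
  have "real (Suc n) powr (a - 1) \<le> z powr (a - 1)"
    using z assms False by (intro powr_mono2') auto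
  then show ?thesis using eq assms by (simp add: mult_left_mono)
qed

text \<open>The cardinality is the rank of \<open>f i\<close> in decreasing order, ties counted in
  full, so no sorting of \<open>I\<close> is needed. The induction removes a minimum, which has the
  largest rank.\<close>

lemma sum_le_of_rank_bound:
  fixes f :: "'i \<Rightarrow> real"
  assumes "finite I" "0 < a" "a \<le> 1" "0 \<le> B"
    and "\<And>i. i \<in> I \<Longrightarrow> f i \<le> B * real (card {j \<in> I. f i \<le> f j}) powr (a - 1)"
  shows "sum f I \<le> B / a * real (card I) powr a"
  using assms(1,5)
proof (induction "card I" arbitrary: I)
  case 0
  then show ?case by simp
next
  case (Suc n)
  then have "I \<noteq> {}" by auto
  then obtain m where m: "m \<in> I" "\<And>j. j \<in> I \<Longrightarrow> f m \<le> f j"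
    using arg_min_if_finite(1)[OF \<open>finite I\<close>] arg_min_least[OF \<open>finite I\<close>] by blast
  let ?J = "I - {m}"
  have n: "n = card ?J" using Suc m(1) by simp
  have "{j \<in> I. f m \<le> f j} = I" using m(2) by auto
  then have fm: "f m \<le> B * real (Suc n) powr (a - 1)"
    using Suc.prems(2)[OF m(1)] Suc.hyps(2) by simp
  have "sum f ?J \<le> B / a * real (card ?J) powr a"
  proof (rule Suc.hyps(1)[OF n])
    show "finite ?J" using Suc.prems(1) by simp
    fix i assume i: "i \<in> ?J"
    \<comment> \<open>Removing \<open>m\<close> can only lower ranks, which weakens the bound since
      \<open>a - 1 \<le> 0\<close>. Ranks must stay positive for this monotonicity, because
      \<open>0 powr (a - 1)\<close> is 0.\<close>
    have "card {j \<in> ?J. f i \<le> f j} \<le> card {j \<in> I. f i \<le> f j}"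
      using Suc.prems(1) by (intro card_mono) auto
    moreover have "card {j \<in> ?J. f i \<le> f j} > 0"
      using i Suc.prems(1) by (auto simp: card_gt_0_iff)
    ultimately have "real (card {j \<in> I. f i \<le> f j}) powr (a - 1)
        \<le> real (card {j \<in> ?J. f i \<le> f j}) powr (a - 1)"
      using assms(3) by (intro powr_mono2') auto
    then show "f i \<le> B * real (card {j \<in> ?J. f i \<le> f j}) powr (a - 1)"
      using Suc.prems(2)[of i] i \<open>0 \<le> B\<close> by (meson DiffD1 mult_left_mono order_trans)
  qed
  then have "sum f I \<le> B * real (Suc n) powr (a - 1) + B / a * real n powr a"
    using fm n Suc.prems(1) m(1) by (simp add: sum.remove)
  also have "\<dots> = B / a * (a * real (Suc n) powr (a - 1) + real n powr a)"
    using assms(2) by (simp add: field_simps)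
  also have "\<dots> \<le> B / a * real (Suc n) powr a"
    using powr_diff_ge[OF assms(2,3), of n] assms(2,4)
    by (intro mult_left_mono) auto
  finally show ?case using Suc.hyps(2) by simp
qed

lemma c_chain_dist_ends_le:
  assumes "c_chain c n p" "1 \<le> c" "1 \<le> i" "i \<le> n"
  shows "dist (p 1) (p i) \<le> c * dist (p 1) (p n)"
proof -
  have D: "dist (p 1) (p n) \<le> c * dist (p 1) (p n)"
    using mult_right_mono[of 1 c "dist (p 1) (p n)"] assms(2) by simp
  \<comment> \<open>The chain condition speaks only of strictly increasing triples, so the end
    vertices rely on \<open>1 \<le> c\<close> instead.\<close>
  consider "i = 1" | "i = n" | "1 < i" "i < n" using assms by linarith
  then show ?thesis
  proof cases
    case 3
    then have "dist (p 1) (p i) + dist (p i) (p n) \<le> c * dist (p 1) (p n)"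
      using assms(1) unfolding c_chain_def by auto
    then show ?thesis using zero_le_dist[of "p i" "p n"] by linarith
  qed (use D assms(2) in auto)
qed

text \<open>The chain condition for \<open>i\<close>, \<open>i + 1\<close>, \<open>j\<close>. It is
  the source of the separation: a long edge at \<open>p i\<close> keeps all later vertices away from
  \<open>p i\<close>.\<close>

lemma c_chain_edge_le:
  assumes "c_chain c n p" "1 \<le> c" "1 \<le> i" "i < j" "j \<le> n"
  shows "dist (p i) (p (i + 1)) \<le> c * dist (p i) (p j)"
proof (cases "j = i + 1")
  case True
  then show ?thesis
    using mult_right_mono[of 1 c "dist (p i) (p j)"] assms(2) by simp
next
  case False
  then have "dist (p i) (p (i + 1)) + dist (p (i + 1)) (p j) \<le> c * dist (p i) (p j)"
    using assms unfolding c_chain_def by auto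
  then show ?thesis using zero_le_dist[of "p (i + 1)" "p j"] by linarith
qed

text \<open>Packing with separation \<open>l / c\<close> in radius \<open>c * ?D\<close>. The upper
  bound on \<open>l\<close> keeps the enlarged radius below \<open>2 * c * ?D\<close>, and dividing
  by \<open>l / c / 2\<close> gives the base of the power.\<close>

lemma c_chain_card_long_edges_le:
  fixes p :: "nat \<Rightarrow> real ^ 'd"
  assumes chain: "c_chain c n p" and c: "1 \<le> c" and l: "0 < l" "l \<le> 2 * c * dist (p 1) (p n)"
  shows "real (card {j \<in> {1..n - 1}. l \<le> dist (p j) (p (j + 1))})
    \<le> (4 * c\<^sup>2 * dist (p 1) (p n) / l) ^ CARD('d)"
proof -
  let ?J = "{j \<in> {1..n - 1}. l \<le> dist (p j) (p (j + 1))}"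
  let ?D = "dist (p 1) (p n)"
  have sep_less: "l / c \<le> dist (p i) (p j)" if "i \<in> ?J" "j \<in> ?J" "i < j" for i j
  proof -
    have "l \<le> dist (p i) (p (i + 1))" "1 \<le> i" "j \<le> n"
      using that by auto
    then have "l \<le> c * dist (p i) (p j)"
      using c_chain_edge_le[OF chain c, of i j] \<open>i < j\<close> by linarith
    then show ?thesis using c by (simp add: field_simps)
  qed
  have sep: "l / c \<le> dist (p i) (p j)" if "i \<in> ?J" "j \<in> ?J" "i \<noteq> j" for i j
  proof (cases "i < j")
    case True
    then show ?thesis using sep_less that(1,2) by blast
  next
    case False
    then have "j < i" using that(3) by linarith
    then show ?thesis using sep_less[OF that(2,1)] by (simp only: dist_commute)
  qed
  have s: "0 < l / c" using l(1) c by simp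
  \<comment> \<open>The packing bound counts points; injectivity turns it into a count of
    edges.\<close>
  have inj: "inj_on p ?J"
  proof (rule inj_onI, rule ccontr)
    fix i j assume "i \<in> ?J" "j \<in> ?J" "p i = p j" "i \<noteq> j"
    then show False using sep[of i j] s by simp
  qed
  have "real (card (p ` ?J)) * (l / c / 2) ^ DIM(real ^ 'd) \<le> (c * ?D + l / c / 2) ^ DIM(real ^ 'd)"
  proof (rule card_separated_le)
    show "p ` ?J \<subseteq> cball (p 1) (c * ?D)"
      using c_chain_dist_ends_le[OF chain c] by auto
  qed (use s sep c in auto)
  then have "real (card ?J) * (l / c / 2) ^ CARD('d) \<le> (c * ?D + l / c / 2) ^ CARD('d)"
    unfolding card_image[OF inj] by simp
  also have "\<dots> \<le> (2 * c * ?D) ^ CARD('d)"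
  proof (rule power_mono)
    have "l / c / 2 \<le> ?D" using l(2) c by (simp add: field_simps)
    also have "?D \<le> c * ?D" using mult_right_mono[of 1 c ?D] c by simp
    finally show "c * ?D + l / c / 2 \<le> 2 * c * ?D" by simp
  qed (use l c in auto)
  finally have "real (card ?J) \<le> (2 * c * ?D) ^ CARD('d) / (l / c / 2) ^ CARD('d)"
    using s by (subst pos_le_divide_eq) simp_all
  also have "\<dots> = (2 * c * ?D / (l / c / 2)) ^ CARD('d)"
    by (simp only: power_divide)
  also have "2 * c * ?D / (l / c / 2) = 4 * c\<^sup>2 * ?D / l"
    using l c by (simp add: field_simps power2_eq_square)
  finally show ?thesis .
qed

lemma c_chain_length_le:
  fixes p :: "nat \<Rightarrow> real ^ 'd"
  assumes chain: "c_chain c n p" and c: "1 \<le> c" and d: "2 \<le> CARD('d)"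
  defines "a \<equiv> (real CARD('d) - 1) / real CARD('d)"
  shows "(\<Sum>i = 1..n - 1. dist (p i) (p (i + 1)))
    \<le> 4 * c\<^sup>2 * dist (p 1) (p n) / a * real (n - 1) powr a"
proof -
  let ?D = "dist (p 1) (p n)"
  let ?B = "4 * c\<^sup>2 * ?D"
  let ?e = "\<lambda>i. dist (p i) (p (i + 1))"
  have a: "0 < a" "a \<le> 1" "a - 1 = - (1 / real CARD('d))"
    using d by (auto simp: a_def field_simps)
  have "sum ?e {1..n - 1} \<le> ?B / a * real (card {1..n - 1}) powr a"
  proof (rule sum_le_of_rank_bound)
    fix i assume i: "i \<in> {1..n - 1}"
    let ?N = "real (card {j \<in> {1..n - 1}. ?e i \<le> ?e j})"
    have i': "1 \<le> i" "i + 1 \<le> n" using i by auto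
    \<comment> \<open>Every edge length is thus an admissible threshold \<open>l\<close> for the
      count of long edges.\<close>
    have "?e i \<le> dist (p 1) (p i) + dist (p 1) (p (i + 1))"
      by (metis dist_commute dist_triangle)
    also have "\<dots> \<le> 2 * c * ?D"
      using c_chain_dist_ends_le[OF chain c, of i] c_chain_dist_ends_le[OF chain c, of "i + 1"] i'
      by linarith
    finally have le: "?e i \<le> 2 * c * ?D" .
    show "?e i \<le> ?B * ?N powr (a - 1)"
    proof (cases "?e i = 0")
      case True
      then show ?thesis by simp
    next
      case False
      then have e: "0 < ?e i" by simp
      have N: "0 < ?N"
        using i by (auto simp: card_gt_0_iff)
      \<comment> \<open>With the edge's own length as threshold, the count is its rank
        \<open>?N\<close>. Taking the root of order \<open>CARD('d)\<close> and solving for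
        \<open>?e i\<close> gives the exponent \<open>a - 1\<close>.\<close>
      have "?N \<le> (?B / ?e i) ^ CARD('d)"
        by (rule c_chain_card_long_edges_le[OF chain c e le])
      then have "?N powr (1 / real CARD('d))
          \<le> ((?B / ?e i) ^ CARD('d)) powr (1 / real CARD('d))"
        using N by (intro powr_mono2) auto
      also have "((?B / ?e i) ^ CARD('d)) powr (1 / real CARD('d)) = ?B / ?e i"
      proof -
        have "?D \<noteq> 0" using e le by auto
        then have "0 < ?D" by simp
        then have "0 < ?B / ?e i" using e c by (intro divide_pos_pos mult_pos_pos) auto
        then show ?thesis using d by (simp add: powr_powr flip: powr_realpow)
      qed
      finally have "?N powr (1 / real CARD('d)) \<le> ?B / ?e i" .
      moreover have "0 < ?N powr (1 / real CARD('d))"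
        using N unfolding powr_gt_zero by linarith
      ultimately have "?e i \<le> ?B / ?N powr (1 / real CARD('d))"
        using e by (simp only: pos_le_divide_eq mult.commute)
      then show ?thesis
        by (simp only: a(3) powr_minus_divide times_divide_eq_right mult_1_right)
    qed
  qed (use a in auto)
  then show ?thesis by simp
qed

theorem theorem8:
  assumes "CARD('d::finite) \<ge> 2"
  shows "\<exists>C::real. C > 0 \<and>
    (\<forall>(c::real) (n::nat) (p :: nat \<Rightarrow> real ^ 'd).
       c \<ge> 1 \<and> n \<ge> 2 \<and> c_chain c n p \<and> p 1 \<noteq> p n \<longrightarrow>
       stretch_factor n p
         \<le> C * c\<^sup>2 * (real n - 1) powr ((real CARD('d) - 1) / real CARD('d)))"
proof -
  define a where "a = (real CARD('d) - 1) / real CARD('d)"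
  have a: "0 < a" using assms by (simp add: a_def)
  \<comment> \<open>The constant \<open>4 / a\<close> depends on the dimension alone: the end
    distance in the length bound cancels against the denominator of the stretch factor.\<close>
  have "stretch_factor n p \<le> 4 / a * c\<^sup>2 * (real n - 1) powr a"
    if "1 \<le> c" "2 \<le> n" "c_chain c n p" "p 1 \<noteq> p n" for c n and p :: "nat \<Rightarrow> real ^ 'd"
  proof -
    have "stretch_factor n p
        \<le> (4 * c\<^sup>2 * dist (p 1) (p n) / a * real (n - 1) powr a) / dist (p 1) (p n)"
      unfolding stretch_factor_def a_def
      by (intro divide_right_mono c_chain_length_le that assms) simp
    also have "\<dots> = 4 / a * c\<^sup>2 * (real n - 1) powr a"
      using that by (simp add: of_nat_diff)
    finally show ?thesis .
  qed
  moreover have "0 < 4 / a" using a by simp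
  ultimately show ?thesis unfolding a_def by blast
qed

end
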